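(* In the nonlinear optimal control setting, suppose there exists a pair $(v_*,\pi_* )$ with $\alpha v_*(x)=\max_{u\in\mathcal U}h(x,u,\nabla v_*(x))$ and $\pi_*(x)=u_*(x,\nabla v_*(x))$ for all $x\in\mathcal X$ such that, with $J_*=-v_*$, (1) $J_*$ is $\mathrm C^1$ with locally Lipschitz gradient, positive definite, and radially unbounded; (2) if $\gamma\ne1$, then either $x_{\mathsf e}=0$ is globally attractive under $\pi_*$, or $\kappa_*J_*\le c_{\pi_*}$ holds pointwise on $\mathcal X$ for a constant $\kappa_*>0$. Then $\pi_*\in\Pi_{\mathsf a}$, $J_*=J_{\pi_*}$, and $J_*\le J_\pi$ (pointwise) for any policy $\pi\in\Pi_0$ such that $$t_{\mathsf{max}}(x;\pi)=\infty\quad\text{and}\quad\lim_{t\to\infty}\mathbb G_\pi^x[\gamma^tJ_*(X_t)]=0\qquad\forall x\in\mathcal X.$$ Moreover, $x_{\mathsf e}=0$ under $\pi_*$ is globally asymptotically stable if $\gamma=1$ or if $\alpha J_*(x)<c_{\pi_*}(x)$ for all $x\in\mathcal X\setminus\{0\}$.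
   Context: Nonlinear optimal control setting. State space $\mathcal X=\mathbb R^l$, $\mathcal X^{\mathsf T}=\mathbb R^{1\times l}$, time space $\mathbb T=[0,\infty)$; the action space $\mathcal U\subseteq\mathbb R^m$ (a set $O\cup\partial O$ or $O$ with $O$ open in $\mathbb R^m$) contains $0$. The system is $\dot X_t=f(X_t,U_t)$ with $f:\mathcal X\times\mathcal U\to\mathcal X$ locally Lipschitz and $f(0,0)=0$. The cost function $c:\mathcal X\times\mathcal U\to\mathbb R$ is continuous and positive definite: $c(0,0)=0$ and $c(x,u)>0$ for $(x,u)\ne(0,0)$; the reward is $r=-c$, and $C_t=c(X_t,U_t)$. $\gamma\in(0,1]$ is the discount factor, $\alpha=-\ln\gamma\ge0$. The Hamiltonian is $h(x,u,p)=r(x,u)+p\,f(x,u)$ (gradients are row vectors), and it is assumed there is a locally Lipschitz $u_*:\mathcal X\times\mathcal X^{\mathsf T}\to\mathcal U$ with $u_*(x,p)\in\arg\max_{u\in\mathcal U}h(x,u,p)$ for all $(x,p)$; this $u_*$ is fixed. A policy is a continuous function $\pi:\mathcal X\to\mathcal U$; write $f_\pi(x)=f(x,\pi(x))$, $c_\pi(x)=c(x,\pi(x))$. $\Pi_0$ is the set of locally Lipschitz policies with $\pi(0)=0$. For a locally Lipschitz policy $\pi$ and $x\in\mathcal X$, $[0,t_{\mathsf{max}}(x;\pi))$ with $t_{\mathsf{max}}(x;\pi)\in(0,\infty]$ is the maximal forward existence interval of the unique solution of $\dot X_t=f_\pi(X_t)$, $X_0=x$ (global existence is not assumed); $\mathbb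 G_\pi^x[Y]$ denotes the value of $Y$ along that solution with $U_t=\pi(X_t)$. The cost value function is $J_\pi(x)=\mathbb G_\pi^x[\int_0^\infty\gamma^tC_t\,dt]\in[0,\infty]$ if $t_{\mathsf{max}}(x;\pi)=\infty$ and $J_\pi(x)=\infty$ otherwise; $v_\pi=-J_\pi$. $\Pi_{\mathsf a}=\{\pi\in\Pi_0: J_\pi(x)<\infty\ \forall x\in\mathcal X\}$ (assumed nonempty). Standing assumptions: for every $\pi\in\Pi_{\mathsf a}$, $v_\pi$ is $\mathrm C^1$ with locally Lipschitz gradient; for every $\pi\in\Pi_0$, $c_\pi$ is radially nonvanishing, i.e., $\inf_{\|x\|\ge\rho}|c_\pi(x)|\not\to0$ as $\rho\to\infty$. A function $g:\mathcal X\to\mathbb R$ is positive definite iff $g(0)=0$ and $g(x)>0$ for $x\ne0$; radially unbounded iff $\inf_{\|x\|\ge\rho}|g(x)|\to\infty$ as $\rho\to\infty$. $x_{\mathsf e}=0$ is globally attractive under $\pi$ iff $t_{\mathsf{max}}(x;\pi)=\infty$ and $\lim_{t\to\infty}\mathbb G_\pi^x[X_t]=0$ for all $x\in\mathcal X$. *)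

theory Defs
  imports "HOL-Analysis.Analysis"
begin

definition locally_lipschitz_on :: "'a::metric_space set \<Rightarrow> ('a \<Rightarrow> 'b::metric_space) \<Rightarrow> bool" where
  "locally_lipschitz_on S g \<longleftrightarrow> local_lipschitz (UNIV :: real set) S (\<lambda>_. g)"

(* Gradients, which are row vectors on paper, are represented by vectors; the product of
   a row vector p with a column vector y is then the inner product of p and y. *)
definition grad :: "('a::real_inner \<Rightarrow> real) \<Rightarrow> 'a \<Rightarrow> 'a" where
  "grad g x = (THE D. GDERIV g x :> D)"

definition C1_lipschitz_gradient :: "('a::real_inner \<Rightarrow> real) \<Rightarrow> bool" where
  "C1_lipschitz_gradient g \<longleftrightarrow>
     (\<forall>x. GDERIV g x :> grad g x) \<and> continuous_on UNIV (grad g) \<and>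
     locally_lipschitz_on UNIV (grad g)"

definition positive_definite :: "('a::zero \<Rightarrow> real) \<Rightarrow> bool" where
  "positive_definite g \<longleftrightarrow> g 0 = 0 \<and> (\<forall>x. x \<noteq> 0 \<longrightarrow> g x > 0)"

(* On a space of positive dimension, the sets over which the infima are taken are nonempty. *)
definition radially_unbounded :: "('a::real_normed_vector \<Rightarrow> real) \<Rightarrow> bool" where
  "radially_unbounded g \<longleftrightarrow>
     filterlim (\<lambda>\<rho>::real. INF x\<in>{x. \<rho> \<le> norm x}. \<bar>g x\<bar>) at_top at_top"

definition radially_nonvanishing :: "('a::real_normed_vector \<Rightarrow> real) \<Rightarrow> bool" where
  "radially_nonvanishing g \<longleftrightarrow>
     \<not> ((\<lambda>\<rho>::real. INF x\<in>{x. \<rho> \<le> norm x}. \<bar>g x\<bar>) \<longlongrightarrow> 0) at_top"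

definition is_maximum_of :: "real \<Rightarrow> real set \<Rightarrow> bool" where
  "is_maximum_of m A \<longleftrightarrow> m \<in> A \<and> (\<forall>a\<in>A. a \<le> m)"

(* X is a solution of the autonomous equation X' = F(X), X(0) = x, on the interval [0,T);
   the derivative at time 0 is one-sided. *)
definition ode_solution ::
  "('a::real_normed_vector \<Rightarrow> 'a) \<Rightarrow> 'a \<Rightarrow> real \<Rightarrow> (real \<Rightarrow> 'a) \<Rightarrow> bool" where
  "ode_solution F x T X \<longleftrightarrow>
     X 0 = x \<and> (\<forall>t\<in>{0..<T}. (X has_vector_derivative F (X t)) (at t within {0..<T}))"

definition ode_tmax :: "('a::real_normed_vector \<Rightarrow> 'a) \<Rightarrow> 'a \<Rightarrow> ereal" where
  "ode_tmax F x = (SUP T\<in>{T. 0 < T \<and> (\<exists>X. ode_solution F x T X)}. ereal T)"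

(* For locally Lipschitz F, all solutions from x agree wherever they are defined, so this
   is the value at time t of the maximal solution whenever 0 \<le> t < ode_tmax F x. *)
definition ode_flow :: "('a::real_normed_vector \<Rightarrow> 'a) \<Rightarrow> 'a \<Rightarrow> real \<Rightarrow> 'a" where
  "ode_flow F x t = (THE y. \<exists>T X. t < T \<and> ode_solution F x T X \<and> y = X t)"

(* f_pi and c_pi *)
definition under_policy :: "('x \<Rightarrow> 'u \<Rightarrow> 'b) \<Rightarrow> ('x \<Rightarrow> 'u) \<Rightarrow> 'x \<Rightarrow> 'b" where
  "under_policy g \<pi> x = g x (\<pi> x)"

definition tmax :: "('x::real_normed_vector \<Rightarrow> 'u \<Rightarrow> 'x) \<Rightarrow> ('x \<Rightarrow> 'u) \<Rightarrow> 'x \<Rightarrow> ereal" where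
  "tmax f \<pi> x = ode_tmax (under_policy f \<pi>) x"

definition state :: "('x::real_normed_vector \<Rightarrow> 'u \<Rightarrow> 'x) \<Rightarrow> ('x \<Rightarrow> 'u) \<Rightarrow> 'x \<Rightarrow> real \<Rightarrow> 'x" where
  "state f \<pi> x t = ode_flow (under_policy f \<pi>) x t"

definition hamiltonian ::
  "('x::real_inner \<Rightarrow> 'u \<Rightarrow> 'x) \<Rightarrow> ('x \<Rightarrow> 'u \<Rightarrow> real) \<Rightarrow> 'x \<Rightarrow> 'u \<Rightarrow> 'x \<Rightarrow> real" where
  "hamiltonian f c x u p = - c x u + p \<bullet> f x u"

definition policies :: "'u::topological_space set \<Rightarrow> ('x::topological_space \<Rightarrow> 'u) set" where
  "policies U = {\<pi>. continuous_on UNIV \<pi> \<and> range \<pi> \<subseteq> U}"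

definition policies0 :: "'u::{metric_space,zero} set \<Rightarrow> ('x::{metric_space,zero} \<Rightarrow> 'u) set" where
  "policies0 U = {\<pi>\<in>policies U. locally_lipschitz_on UNIV \<pi> \<and> \<pi> 0 = 0}"

definition cost_value ::
  "('x::real_normed_vector \<Rightarrow> 'u \<Rightarrow> 'x) \<Rightarrow> ('x \<Rightarrow> 'u \<Rightarrow> real) \<Rightarrow> real \<Rightarrow> ('x \<Rightarrow> 'u) \<Rightarrow> 'x \<Rightarrow> ennreal" where
  "cost_value f c \<gamma> \<pi> x =
     (if tmax f \<pi> x = \<infinity>
      then (\<integral>\<^sup>+t\<in>{0..}. ennreal (\<gamma> powr t * under_policy c \<pi> (state f \<pi> x t)) \<partial>lborel)
      else \<infinity>)"

definition admissible_policies ::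
  "('x::real_normed_vector \<Rightarrow> 'u \<Rightarrow> 'x) \<Rightarrow> ('x \<Rightarrow> 'u \<Rightarrow> real) \<Rightarrow> real \<Rightarrow> 'u::{metric_space,zero} set
     \<Rightarrow> ('x \<Rightarrow> 'u) set" where
  "admissible_policies f c \<gamma> U = {\<pi>\<in>policies0 U. \<forall>x. cost_value f c \<gamma> \<pi> x < \<infinity>}"

(* v_pi; only used for admissible policies, whose cost value is finite everywhere. *)
definition value_fun ::
  "('x::real_normed_vector \<Rightarrow> 'u \<Rightarrow> 'x) \<Rightarrow> ('x \<Rightarrow> 'u \<Rightarrow> real) \<Rightarrow> real \<Rightarrow> ('x \<Rightarrow> 'u) \<Rightarrow> 'x \<Rightarrow> real" where
  "value_fun f c \<gamma> \<pi> x = - enn2real (cost_value f c \<gamma> \<pi> x)"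

definition globally_attractive :: "('x::real_normed_vector \<Rightarrow> 'u \<Rightarrow> 'x) \<Rightarrow> ('x \<Rightarrow> 'u) \<Rightarrow> bool" where
  "globally_attractive f \<pi> \<longleftrightarrow> (\<forall>x. tmax f \<pi> x = \<infinity> \<and> (state f \<pi> x \<longlongrightarrow> 0) at_top)"

definition lyapunov_stable :: "('x::real_normed_vector \<Rightarrow> 'u \<Rightarrow> 'x) \<Rightarrow> ('x \<Rightarrow> 'u) \<Rightarrow> bool" where
  "lyapunov_stable f \<pi> \<longleftrightarrow>
     (\<forall>\<epsilon>>0. \<exists>\<delta>>0. \<forall>x. norm x < \<delta> \<longrightarrow>
        tmax f \<pi> x = \<infinity> \<and> (\<forall>t\<ge>0. norm (state f \<pi> x t) < \<epsilon>))"

definition globally_asymptotically_stable ::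
  "('x::real_normed_vector \<Rightarrow> 'u \<Rightarrow> 'x) \<Rightarrow> ('x \<Rightarrow> 'u) \<Rightarrow> bool" where
  "globally_asymptotically_stable f \<pi> \<longleftrightarrow> lyapunov_stable f \<pi> \<and> globally_attractive f \<pi>"

end

theory Submission
  imports Defs
begin

text \<open>Along a trajectory of \<open>\<pi>\<^sub>*\<close> the HJB equation reads
  \<open>d/dt J\<^sub>*(X\<^sub>t) = \<alpha> J\<^sub>*(X\<^sub>t) - c\<^bsub>\<pi>\<^sub>*\<^esub>(X\<^sub>t)\<close>. Hence \<open>J\<^sub>*\<close> grows at most exponentially, which confines the
  state to sublevel sets of \<open>J\<^sub>*\<close> in finite time and rules out explosion, and
  \<open>d/dt (\<gamma>\<^sup>t J\<^sub>*(X\<^sub>t)) = - \<gamma>\<^sup>t c\<^bsub>\<pi>\<^sub>*\<^esub>(X\<^sub>t)\<close>, so that \<open>J\<^sub>* = J\<^bsub>\<pi>\<^sub>*\<^esub>\<close> once \<open>\<gamma>\<^sup>t J\<^sub>*(X\<^sub>t) \<rightarrow> 0\<close>. For another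
  policy, the last equation becomes \<open>\<ge>\<close>, which gives \<open>J\<^sub>* \<le> J\<^sub>\<pi>\<close>. If \<open>c\<^bsub>\<pi>\<^sub>*\<^esub> - \<alpha> J\<^sub>*\<close> is positive
  definite, in particular if \<open>\<gamma> = 1\<close>, then \<open>J\<^sub>*\<close> is a strict Lyapunov function; for \<open>\<gamma> = 1\<close> this is
  also what yields \<open>J\<^sub>*(X\<^sub>t) \<rightarrow> 0\<close>.\<close>

section \<open>Locally Lipschitz maps\<close>

text \<open>The map does not depend on time, so the time neighbourhood that
  \<open>local_lipschitz\<close> carries imposes nothing and only the balls in space remain.\<close>

lemma locally_lipschitz_on_iff:
  "locally_lipschitz_on S g \<longleftrightarrow> (\<forall>x\<in>S. \<exists>u>0. \<exists>L. L-lipschitz_on (cball x u \<inter> S) g)"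
  unfolding locally_lipschitz_on_def local_lipschitz_def
  by (metis IntI UNIV_I centre_in_cball less_eq_real_def)

lemma locally_lipschitz_on_imp_continuous_on:
  assumes "locally_lipschitz_on S g"
  shows "continuous_on S g"
  using assms local_lipschitz_continuous_on[of UNIV S "\<lambda>_. g" 0]
  unfolding locally_lipschitz_on_def by auto

lemma locally_lipschitz_on_compose:
  assumes f: "locally_lipschitz_on S f" and g: "locally_lipschitz_on T g" and sub: "f ` S \<subseteq> T"
  shows "locally_lipschitz_on S (\<lambda>x. g (f x))"
  unfolding locally_lipschitz_on_iff
proof
  fix x assume x: "x \<in> S"
  obtain u L where u: "u > 0" "L-lipschitz_on (cball x u \<inter> S) f"
    using f x unfolding locally_lipschitz_on_iff by blast
  obtain v M where v: "v > 0" "M-lipschitz_on (cball (f x) v \<inter> T) g"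
    using g x sub unfolding locally_lipschitz_on_iff by blast
  obtain d where d: "d > 0" "\<And>y. y \<in> S \<Longrightarrow> dist y x < d \<Longrightarrow> dist (f y) (f x) < v"
    using locally_lipschitz_on_imp_continuous_on[OF f] x v(1) unfolding continuous_on_iff by metis
  \<comment> \<open>\<open>f\<close> is Lipschitz within radius \<open>u\<close>. Halving
    \<open>d\<close> turns the open condition \<open>dist y x < d\<close> into one valid on the
    whole closed ball, so that \<open>f\<close> maps this ball to where \<open>g\<close> is
    Lipschitz.\<close>
  define w where "w = min u (d/2)"
  have w: "w > 0" "w \<le> u" "w < d" using u d by (auto simp: w_def)
  have "f ` (cball x w \<inter> S) \<subseteq> cball (f x) v \<inter> T"
    using d(2) w(3) sub by (auto simp: dist_commute less_imp_le)
  then have "M-lipschitz_on (f ` (cball x w \<inter> S)) g"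
    using v(2) lipschitz_on_subset by blast
  moreover have "L-lipschitz_on (cball x w \<inter> S) f"
    using u(2) w by (meson Int_mono lipschitz_on_subset order_refl subset_cball)
  ultimately show "\<exists>u>0. \<exists>L. L-lipschitz_on (cball x u \<inter> S) (\<lambda>x. g (f x))"
    using lipschitz_on_compose2 w(1) by blast
qed

lemma locally_lipschitz_on_Pair:
  assumes f: "locally_lipschitz_on S f" and g: "locally_lipschitz_on S g"
  shows "locally_lipschitz_on S (\<lambda>x. (f x, g x))"
  unfolding locally_lipschitz_on_iff
proof
  fix x assume x: "x \<in> S"
  obtain u L where u: "u > 0" "L-lipschitz_on (cball x u \<inter> S) f"
    using f x unfolding locally_lipschitz_on_iff by blast
  obtain v M where v: "v > 0" "M-lipschitz_on (cball x v \<inter> S) g"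
    using g x unfolding locally_lipschitz_on_iff by blast
  have "L-lipschitz_on (cball x (min u v) \<inter> S) f" "M-lipschitz_on (cball x (min u v) \<inter> S) g"
    by (rule lipschitz_on_subset[OF u(2)], auto, rule lipschitz_on_subset[OF v(2)], auto)
  then show "\<exists>u>0. \<exists>L. L-lipschitz_on (cball x u \<inter> S) (\<lambda>x. (f x, g x))"
    using lipschitz_on_Pair u(1) v(1) by (metis min_less_iff_conj)
qed

lemma locally_lipschitz_on_ident: "locally_lipschitz_on S (\<lambda>x. x)"
  unfolding locally_lipschitz_on_iff lipschitz_on_def
  by (metis dist_commute less_eq_real_def mult_1 zero_less_one)

lemma locally_lipschitz_on_uminus:
  fixes g :: "_ \<Rightarrow> 'b::real_normed_vector"
  assumes "locally_lipschitz_on S g"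
  shows "locally_lipschitz_on S (\<lambda>x. - g x)"
  using assms unfolding locally_lipschitz_on_iff by simp

lemma locally_lipschitz_on_compact:
  assumes "locally_lipschitz_on S g" "compact K" "K \<subseteq> S"
  obtains L where "L-lipschitz_on K g"
proof -
  have "local_lipschitz {0::real} K (\<lambda>_. g)"
    using assms local_lipschitz_subset unfolding locally_lipschitz_on_def by blast
  then obtain L where "\<And>t. t \<in> {0::real} \<Longrightarrow> L-lipschitz_on K g"
    using local_lipschitz_compact_implies_lipschitz[where X=K and T="{0::real}" and f="\<lambda>_. g"] assms(2) by auto
  then show ?thesis using that by blast
qed

section \<open>Solutions of autonomous equations\<close>

lemma ode_solution_mono:
  assumes "ode_solution F x T X" "T' \<le> T"
  shows "ode_solution F x T' X"
  using assms unfolding ode_solution_def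
  by (auto intro!: has_vector_derivative_within_subset[where T="{0..<T'}" and S="{0..<T}"])

lemma ode_solution_at_within_Icc:
  assumes "ode_solution F x T X" "t < T" "s \<in> {0..t}"
  shows "(X has_vector_derivative F (X s)) (at s within {0..t})"
  using assms unfolding ode_solution_def
  by (auto intro: has_vector_derivative_within_subset[where S="{0..<T}"])

lemma ode_solution_continuous_on:
  assumes "ode_solution F x T X" "t < T"
  shows "continuous_on {0..t} X"
  using ode_solution_at_within_Icc[OF assms]
  by (rule continuous_on_vector_derivative)

text \<open>A Gronwall argument: both trajectories up to time \<open>t\<close> lie in one compact
  set, on which \<open>F\<close> has a single Lipschitz constant \<open>L\<close>. The squared
  distance weighted by \<open>exp (- 2 * L * s)\<close> is then nonincreasing, and it starts at
  zero.\<close>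

lemma ode_solution_unique:
  fixes F :: "'a::euclidean_space \<Rightarrow> 'a"
  assumes F: "locally_lipschitz_on UNIV F"
    and X: "ode_solution F x T X" and Y: "ode_solution F x T' Y"
    and t: "0 \<le> t" "t < T" "t < T'"
  shows "X t = Y t"
proof -
  have cX: "continuous_on {0..t} X" and cY: "continuous_on {0..t} Y"
    using ode_solution_continuous_on X Y t by blast+
  have "compact (X ` {0..t} \<union> Y ` {0..t})"
    using cX cY by (intro compact_Un compact_continuous_image) auto
  then obtain L where L: "L-lipschitz_on (X ` {0..t} \<union> Y ` {0..t}) F"
    using locally_lipschitz_on_compact[OF F] by blast
  define \<phi> where "\<phi> s = exp (- 2 * L * s) * ((X s - Y s) \<bullet> (X s - Y s))" for s
  have "\<phi> t \<le> \<phi> 0"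
  proof (rule DERIV_nonpos_imp_decreasing_open[where f=\<phi> and a=0 and b=t])
    fix s assume s: "0 < s" "s < t"
    have at: "at s within {0..t} = at s" using s by (simp add: at_within_Icc_at)
    have X': "(X has_derivative (\<lambda>h. h *\<^sub>R F (X s))) (at s)"
      and Y': "(Y has_derivative (\<lambda>h. h *\<^sub>R F (Y s))) (at s)"
      using ode_solution_at_within_Icc[OF X, of t s] ode_solution_at_within_Icc[OF Y, of t s] s t at
      by (auto simp: has_vector_derivative_def)
    let ?d = "exp (- 2 * L * s) * (2 * ((X s - Y s) \<bullet> (F (X s) - F (Y s))) - 2 * L * ((X s - Y s) \<bullet> (X s - Y s)))"
    have "(\<phi> has_real_derivative ?d) (at s)"
      unfolding \<phi>_def has_field_derivative_def
      by (rule derivative_eq_intros X' Y' refl)+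
        (auto simp: fun_eq_iff algebra_simps inner_commute)
    moreover have "(X s - Y s) \<bullet> (F (X s) - F (Y s)) \<le> L * ((X s - Y s) \<bullet> (X s - Y s))"
    proof -
      have "(X s - Y s) \<bullet> (F (X s) - F (Y s)) \<le> norm (X s - Y s) * norm (F (X s) - F (Y s))"
        by (rule norm_cauchy_schwarz)
      also have "\<dots> \<le> norm (X s - Y s) * (L * norm (X s - Y s))"
        using s by (intro mult_left_mono lipschitz_on_normD[OF L]) auto
      also have "\<dots> = L * ((X s - Y s) \<bullet> (X s - Y s))"
        by (simp add: dot_square_norm power2_eq_square)
      finally show ?thesis .
    qed
    then have "?d \<le> 0" by (auto simp: mult_le_0_iff)
    ultimately show "\<exists>y. (\<phi> has_real_derivative y) (at s) \<and> y \<le> 0" by blast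
  next
    show "continuous_on {0..t} \<phi>" unfolding \<phi>_def by (intro continuous_intros cX cY)
  qed (use t in auto)
  also have "\<phi> 0 = 0" using X Y by (simp add: \<phi>_def ode_solution_def)
  finally have "(X t - Y t) \<bullet> (X t - Y t) \<le> 0" by (simp add: \<phi>_def mult_le_0_iff)
  then have "X t - Y t = 0" by (metis inner_eq_zero_iff inner_ge_zero order_antisym)
  then show ?thesis by simp
qed

lemma ode_flow_eq:
  fixes F :: "'a::euclidean_space \<Rightarrow> 'a"
  assumes F: "locally_lipschitz_on UNIV F" and X: "ode_solution F x T X" and t: "0 \<le> t" "t < T"
  shows "ode_flow F x t = X t"
  unfolding ode_flow_def
  using ode_solution_unique[OF F X _ t(1,2)] X t by (intro the_equality) (blast, metis)

text \<open>An infinite supremum of existence times yields a solution on an interval longer than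
  \<open>T\<close>. By uniqueness the flow coincides with it there and inherits its
  derivative.\<close>

lemma ode_solution_flow:
  fixes F :: "'a::euclidean_space \<Rightarrow> 'a"
  assumes F: "locally_lipschitz_on UNIV F" and "ode_tmax F x = \<infinity>"
  shows "ode_solution F x T (ode_flow F x)"
proof -
  have "ereal T < ode_tmax F x" using assms(2) by simp
  then obtain S X where S: "T < S" "0 < S" and X: "ode_solution F x S X"
    unfolding ode_tmax_def less_SUP_iff by auto
  have eq: "ode_flow F x t = X t" if "t \<in> {0..<S}" for t
    using ode_flow_eq[OF F X] that by auto
  have "(ode_flow F x has_vector_derivative F (X t)) (at t within {0..<S})" if "t \<in> {0..<S}" for t
    using has_vector_derivative_transform[of t "{0..<S}" "ode_flow F x" X] X that eq
    unfolding ode_solution_def by blast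
  then have "ode_solution F x S (ode_flow F x)"
    using X S unfolding ode_solution_def by (auto simp: eq)
  then show ?thesis by (rule ode_solution_mono) (use S in auto)
qed

section \<open>Global existence of solutions\<close>

lemma ode_tmax_eq_top:
  assumes "\<And>T. T > 0 \<Longrightarrow> \<exists>X. ode_solution F x T X"
  shows "ode_tmax F x = \<infinity>"
  unfolding ode_tmax_def
proof (rule SUP_PInfty)
  show "\<exists>T\<in>{T. 0 < T \<and> (\<exists>X. ode_solution F x T X)}. ereal (real n) \<le> ereal T" for n
    \<comment> \<open>Adding one keeps the existence time positive when
      \<open>n = 0\<close>.\<close>
    using assms by (intro bexI[of _ "real n + 1"]) auto
qed

text \<open>Differentiability is local: near \<open>t\<close> the half-line looks like
  \<open>{0..t+1}\<close>, where the fundamental theorem of calculus applies.\<close>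

lemma integral_from_0_has_vector_derivative:
  fixes h :: "real \<Rightarrow> 'a::banach"
  assumes "continuous_on {0..} h" "0 \<le> t"
  shows "((\<lambda>s. integral {0..s} h) has_vector_derivative h t) (at t within {0..})"
proof -
  have "((\<lambda>s. integral {0..s} h) has_vector_derivative h t) (at t within {0..t+1})"
    by (rule integral_has_vector_derivative) (use assms in \<open>auto intro: continuous_on_subset\<close>)
  moreover have "at t within {0..} = at t within {0..t+1}"
    by (rule at_within_nhd[of _ "{..<t+1}"]) (use assms in auto)
  ultimately show ?thesis by simp
qed

text \<open>The Picard operator is a contraction for the weighted norm
  \<open>sup\<^sub>t exp (- K t) \<parallel>X t\<parallel>\<close> with \<open>K\<close> twice the Lipschitz constant; the fixed point is sought in the
  form \<open>X t = exp (K t) Y t\<close> with \<open>Y\<close> bounded.\<close>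
lemma bounded_lipschitz_ode_solution:
  fixes G :: "'a::banach \<Rightarrow> 'a"
  assumes lip: "L-lipschitz_on UNIV G" and bdd: "\<And>x. norm (G x) \<le> M"
  shows "\<exists>X. \<forall>T. ode_solution G x T X"
proof -
  \<comment> \<open>The summand 1 keeps \<open>K\<close> positive even if \<open>L = 0\<close>,
    while \<open>L / K \<le> 1/2\<close> will be the contraction factor.\<close>
  define K where "K = 2 * (L + 1)"
  have L: "0 \<le> L" using lip lipschitz_on_nonneg by blast
  then have K: "K > 0" "L / K \<le> 1/2" by (auto simp: K_def field_simps)
  have contG: "continuous_on UNIV G" using lip lipschitz_on_continuous_on by blast
  have M: "M \<ge> 0" using bdd[of 0] norm_ge_zero order_trans by blast
  \<comment> \<open>Bounded continuous functions form a complete space when defined on all of the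
    real line, so the operator is extended to negative times by its value at 0, through
    \<open>max 0 t\<close>.\<close>
  define \<Phi> where "\<Phi> Y t = exp (- K * max 0 t) *\<^sub>R
      (x + integral {0..max 0 t} (\<lambda>s. G (exp (K * s) *\<^sub>R Y s)))" for Y t
  have cont: "continuous_on S (\<lambda>s. G (exp (K * s) *\<^sub>R Y s))" if "continuous_on UNIV Y" for Y S
    by (rule continuous_on_compose2[OF contG])
      (auto intro!: continuous_intros continuous_on_subset[OF that])
  have int: "(\<lambda>s. G (exp (K * s) *\<^sub>R Y s)) integrable_on {0..t}" if "continuous_on UNIV Y" for Y t
    using cont[OF that] integrable_continuous_real by blast
  have mem: "\<Phi> Y \<in> bcontfun" if Y: "continuous_on UNIV Y" for Y
  proof (rule bcontfun_normI)
    have "continuous_on {0..} (\<lambda>u. integral {0..u} (\<lambda>s. G (exp (K * s) *\<^sub>R Y s)))"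
      using integral_from_0_has_vector_derivative[OF cont[OF Y]]
      by (auto intro!: continuous_on_vector_derivative)
    then have "continuous_on UNIV (\<lambda>t. integral {0..max 0 t} (\<lambda>s. G (exp (K * s) *\<^sub>R Y s)))"
      by (rule continuous_on_compose2) (auto intro!: continuous_intros)
    then show "continuous_on UNIV (\<Phi> Y)"
      unfolding \<Phi>_def by (intro continuous_intros)
    fix t :: real
    define u where "u = max 0 t"
    have u: "u \<ge> 0" by (simp add: u_def)
    have "norm (integral {0..u} (\<lambda>s. G (exp (K * s) *\<^sub>R Y s))) \<le> M * (u - 0)"
      by (rule integral_bound) (use u bdd cont[OF Y] in auto)
    then have "norm (\<Phi> Y t) \<le> exp (- K * u) * (norm x + M * u)"
      unfolding \<Phi>_def u_def[symmetric]
      by (auto intro!: mult_left_mono norm_triangle_le)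
    \<comment> \<open>The linear growth \<open>M * u\<close> of the integral is absorbed by the
      weight, since \<open>K * u \<le> exp (K * u)\<close>.\<close>
    also have "\<dots> = exp (- K * u) * norm x + M / K * (exp (- K * u) * (K * u))"
      using K by (simp add: field_simps)
    also have "\<dots> \<le> 1 * norm x + M / K * 1"
    proof (intro add_mono mult_right_mono mult_left_mono)
      have "K * u \<le> exp (K * u)" using exp_ge_add_one_self[of "K * u"] by linarith
      then have "exp (- K * u) * (K * u) \<le> exp (- K * u) * exp (K * u)" by (intro mult_left_mono) auto
      then show "exp (- K * u) * (K * u) \<le> 1" by (simp flip: exp_add)
    qed (use u K M in auto)
    finally show "norm (\<Phi> Y t) \<le> norm x + M / K" by simp
  qed
  define \<Psi> where "\<Psi> Y = Bcontfun (\<Phi> (apply_bcontfun Y))" for Y :: "real \<Rightarrow>\<^sub>C 'a"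
  have \<Psi>: "apply_bcontfun (\<Psi> Y) = \<Phi> (apply_bcontfun Y)" for Y
    unfolding \<Psi>_def by (rule Bcontfun_inverse) (simp add: mem)
  have "\<exists>!Y. \<Psi> Y = Y"
  proof (rule banach_fix_type[of "1/2"], safe)
    fix Y Z :: "real \<Rightarrow>\<^sub>C 'a"
    have "dist (\<Phi> Y t) (\<Phi> Z t) \<le> 1/2 * dist Y Z" for t
    proof -
      define u where "u = max 0 t"
      have u: "u \<ge> 0" by (simp add: u_def)
      let ?I = "\<lambda>Y. integral {0..u} (\<lambda>s. G (exp (K * s) *\<^sub>R apply_bcontfun Y s))"
      have exp_int: "((\<lambda>s. L * (exp (K * s) * dist Y Z)) has_integral
          L * (exp (K * u) / K * dist Y Z) - L * (exp (K * 0) / K * dist Y Z)) {0..u}"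
        by (rule fundamental_theorem_of_calculus[OF u])
          (use K in \<open>auto simp flip: has_real_derivative_iff_has_vector_derivative
            intro!: derivative_eq_intros\<close>)
      have "norm (?I Y - ?I Z) =
          norm (integral {0..u} (\<lambda>s. G (exp (K * s) *\<^sub>R Y s) - G (exp (K * s) *\<^sub>R Z s)))"
        by (simp add: integral_diff int)
      also have "\<dots> \<le> integral {0..u} (\<lambda>s. L * (exp (K * s) * dist Y Z))"
      proof (rule integral_norm_bound_integral)
        fix s
        have "norm (G (exp (K * s) *\<^sub>R Y s) - G (exp (K * s) *\<^sub>R Z s))
            \<le> L * norm (exp (K * s) *\<^sub>R Y s - exp (K * s) *\<^sub>R Z s)"
          by (rule lipschitz_on_normD[OF lip]) auto
        also have "\<dots> = L * (exp (K * s) * dist (Y s) (Z s))"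
          by (simp add: dist_norm flip: scaleR_diff_right)
        also have "\<dots> \<le> L * (exp (K * s) * dist Y Z)"
          using L by (intro mult_left_mono dist_bounded) auto
        finally show "norm (G (exp (K * s) *\<^sub>R Y s) - G (exp (K * s) *\<^sub>R Z s))
            \<le> L * (exp (K * s) * dist Y Z)" .
      qed (use exp_int in \<open>auto intro!: integrable_diff int\<close>)
      also have "\<dots> \<le> L * (exp (K * u) / K * dist Y Z)"
        unfolding integral_unique[OF exp_int] using K L by simp
      finally have I: "norm (?I Y - ?I Z) \<le> L * (exp (K * u) / K * dist Y Z)" .
      \<comment> \<open>The weight cancels the factor \<open>exp (K * u)\<close> from the integral
        bound, leaving \<open>L / K\<close>, uniformly in \<open>t\<close>.\<close>
      have "dist (\<Phi> Y t) (\<Phi> Z t) = exp (- K * u) * norm (?I Y - ?I Z)"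
        unfolding \<Phi>_def u_def[symmetric] by (simp add: dist_norm flip: scaleR_diff_right)
      also have "\<dots> \<le> exp (- K * u) * (L * (exp (K * u) / K * dist Y Z))"
        by (intro mult_left_mono I) auto
      also have "\<dots> = L / K * dist Y Z" by (simp add: exp_minus field_simps)
      also have "\<dots> \<le> 1/2 * dist Y Z" by (intro mult_right_mono K) auto
      finally show ?thesis .
    qed
    then show "dist (\<Psi> Y) (\<Psi> Z) \<le> 1/2 * dist Y Z" by (intro dist_bound) (simp add: \<Psi>)
  qed auto
  then obtain Y where Y: "\<Psi> Y = Y" by blast
  define X where "X t = exp (K * t) *\<^sub>R apply_bcontfun Y t" for t
  have X: "X t = x + integral {0..t} (\<lambda>s. G (X s))" if "t \<ge> 0" for t
  proof -
    have "X t = exp (K * t) *\<^sub>R \<Phi> Y t" unfolding X_def by (metis Y \<Psi>)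
    then show ?thesis using that unfolding \<Phi>_def X_def[symmetric] by (simp flip: exp_add)
  qed
  have deriv: "(X has_vector_derivative G (X t)) (at t within {0..})" if t: "t \<ge> 0" for t
  proof (rule has_vector_derivative_transform)
    have "continuous_on {0..} (\<lambda>s. G (X s))" unfolding X_def by (rule cont) auto
    then show "((\<lambda>s. x + integral {0..s} (\<lambda>s. G (X s))) has_vector_derivative G (X t)) (at t within {0..})"
      using integral_from_0_has_vector_derivative t by (auto intro!: derivative_eq_intros)
  qed (use X t in auto)
  have "ode_solution G x T X" for T
    unfolding ode_solution_def
    using X[of 0] has_vector_derivative_within_subset[OF deriv, of _ "{0..<T}"]
    by (auto simp: atLeastLessThan_def)
  then show ?thesis by blast
qed

section \<open>Lyapunov functions\<close>

text \<open>Some radius \<open>\<rho>\<close> makes the infimum of \<open>\<bar>g x\<bar>\<close>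
  over \<open>\<rho> \<le> norm x\<close> exceed \<open>r\<close>, so no point of the sublevel set
  lies beyond that radius.\<close>

lemma radially_unbounded_imp_bounded_sublevel:
  assumes "radially_unbounded g"
  shows "bounded {x. \<bar>g x\<bar> \<le> r}"
proof -
  have "\<forall>\<^sub>F \<rho> in at_top. r < (INF x\<in>{x. \<rho> \<le> norm x}. \<bar>g x\<bar>)"
    using assms unfolding radially_unbounded_def filterlim_at_top_dense by blast
  then obtain \<rho> where \<rho>: "r < (INF x\<in>{x. \<rho> \<le> norm x}. \<bar>g x\<bar>)"
    unfolding eventually_at_top_linorder by blast
  have "norm x \<le> \<rho>" if x: "\<bar>g x\<bar> \<le> r" for x
  proof (rule ccontr)
    assume "\<not> norm x \<le> \<rho>"
    then have "(INF x\<in>{x. \<rho> \<le> norm x}. \<bar>g x\<bar>) \<le> \<bar>g x\<bar>"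
      by (intro cINF_lower bdd_belowI[of _ 0]) auto
    with \<rho> x show False by linarith
  qed
  then show ?thesis unfolding bounded_iff by blast
qed

lemma GDERIV_compose_vector_derivative:
  assumes V: "GDERIV V (X t) :> D" and X: "(X has_vector_derivative X') (at t within S)"
  shows "((\<lambda>s. V (X s)) has_real_derivative D \<bullet> X') (at t within S)"
proof -
  have "((\<lambda>s. V (X s)) has_derivative (\<lambda>h. (h *\<^sub>R X') \<bullet> D)) (at t within S)"
    using has_derivative_compose[of X "\<lambda>h. h *\<^sub>R X'" t S V "\<lambda>h. h \<bullet> D"] V X
    unfolding gderiv_def has_vector_derivative_def by blast
  moreover have "(\<lambda>h. (h *\<^sub>R X') \<bullet> D) = (*) (D \<bullet> X')"
    by (auto simp: inner_commute)
  ultimately show ?thesis by (simp add: has_field_derivative_def)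
qed

text \<open>The integrating factor turns a growth bound \<open>D \<bullet> X' \<le> a * V\<close>
  into monotonicity of the weighted value. For \<open>a = - ln \<gamma>\<close> with
  \<open>\<gamma>\<close> positive it is the discount \<open>\<gamma> powr t\<close>.\<close>

lemma discounted_has_real_derivative:
  assumes "GDERIV V (X t) :> D" "(X has_vector_derivative X') (at t within S)"
  shows "((\<lambda>s. exp (- a * s) * V (X s)) has_real_derivative
    exp (- a * t) * (D \<bullet> X' - a * V (X t))) (at t within S)"
  by (rule derivative_eq_intros GDERIV_compose_vector_derivative[OF assms] refl)+
    (simp add: algebra_simps)

lemma GDERIV_imp_continuous_on:
  assumes "\<And>x. GDERIV V x :> DV x"
  shows "continuous_on S V"
  using assms unfolding gderiv_def
  by (meson continuous_at_imp_continuous_on has_derivative_continuous)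

text \<open>Cutting off the field outside a ball containing the relevant sublevel set of \<open>V\<close> makes it
  globally Lipschitz; the solution of the modified equation never leaves that ball.\<close>
lemma lyapunov_ode_tmax:
  fixes F :: "'a::euclidean_space \<Rightarrow> 'a"
  assumes F: "locally_lipschitz_on UNIV F"
    and V: "\<And>x. GDERIV V x :> DV x" and nonneg: "\<And>x. V x \<ge> 0"
    and unbdd: "radially_unbounded V"
    and a: "a \<ge> 0" and growth: "\<And>x. DV x \<bullet> F x \<le> a * V x"
  shows "ode_tmax F x = \<infinity>"
proof (rule ode_tmax_eq_top)
  fix T :: real assume T: "T > 0"
  \<comment> \<open>\<open>exp (a * T) * V x\<close> is the largest value that the growth bound lets
    \<open>V\<close> reach up to time \<open>T\<close>.\<close>
  have "bounded {y. \<bar>V y\<bar> \<le> exp (a * T) * V x}"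
    by (rule radially_unbounded_imp_bounded_sublevel[OF unbdd])
  then obtain R where R: "R > 0" "\<And>y. V y \<le> exp (a * T) * V x \<Longrightarrow> norm y < R"
    unfolding bounded_pos_less using nonneg by auto
  \<comment> \<open>Projection onto the ball is 1-Lipschitz and fixes the ball pointwise. Hence
    \<open>F (P y)\<close> is bounded and globally Lipschitz, and agrees with \<open>F\<close> on
    the ball.\<close>
  define P where "P = closest_point (cball 0 R :: 'a set)"
  have P: "norm (P y) \<le> R" "norm y \<le> R \<Longrightarrow> P y = y" for y
    using closest_point_in_set[of "cball 0 R" y] R(1) closest_point_self[of y "cball 0 R"]
    by (auto simp: P_def)
  have "compact (F ` cball 0 R)"
    by (intro compact_continuous_image continuous_on_subset[OF locally_lipschitz_on_imp_continuous_on[OF F]])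
      auto
  then obtain M where "\<forall>z\<in>F ` cball 0 R. norm z \<le> M"
    using compact_imp_bounded bounded_iff by metis
  then have M: "norm (F y) \<le> M" if "norm y \<le> R" for y using that by simp
  obtain L where L: "L-lipschitz_on (cball 0 R) F"
    using locally_lipschitz_on_compact[OF F] compact_cball by blast
  have "1-lipschitz_on UNIV P"
    using R(1) closest_point_lipschitz[of "cball (0::'a) R"]
    unfolding P_def by (intro lipschitz_onI) auto
  moreover have "L-lipschitz_on (P ` UNIV) F"
    using L by (rule lipschitz_on_subset) (use P in auto)
  ultimately have "(L * 1)-lipschitz_on UNIV (\<lambda>y. F (P y))" by (rule lipschitz_on_compose2)
  then obtain X where X: "\<And>T. ode_solution (\<lambda>y. F (P y)) x T X"
    using bounded_lipschitz_ode_solution[of "L * 1" "\<lambda>y. F (P y)" M x] M P by blast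
  have X0: "X 0 = x" using X unfolding ode_solution_def by blast
  have contX: "continuous_on {0..t} X" for t
    using ode_solution_continuous_on[OF X, of t "t + 1"] by simp
  have inside: "norm (X t) < R" if t: "t \<in> {0..T}" for t
  proof (rule ccontr)
    \<comment> \<open>The least element \<open>\<tau>\<close> of this compact set is the first exit
      time. Before it the modified field equals \<open>F\<close>, so the bound on \<open>V\<close>
      holds up to \<open>\<tau>\<close> and contradicts
      \<open>R \<le> norm (X \<tau>)\<close>.\<close>
    define E where "E = {0..T} \<inter> (\<lambda>s. norm (X s)) -` {R..}"
    assume "\<not> norm (X t) < R"
    then have ne: "E \<noteq> {}" using t by (auto simp: E_def)
    have "closed E" unfolding E_def
      by (rule continuous_closed_preimage) (auto intro!: continuous_intros contX)
    then have "compact E" unfolding E_def by (metis bounded_Int bounded_closed_interval compact_eq_bounded_closed)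
    then obtain \<tau> where \<tau>: "\<tau> \<in> E" "\<And>s. s \<in> E \<Longrightarrow> \<tau> \<le> s"
      using compact_attains_inf[OF _ ne] by blast
    then have \<tau>T: "0 \<le> \<tau>" "\<tau> \<le> T" "R \<le> norm (X \<tau>)" by (auto simp: E_def)
    define p where "p s = exp (- a * s) * V (X s)" for s
    have "p \<tau> \<le> p 0"
    proof (rule DERIV_nonpos_imp_decreasing_open[where f=p and a=0 and b=\<tau>])
      fix s assume s: "0 < s" "s < \<tau>"
      have "norm (X s) < R" using \<tau>(2)[of s] s \<tau>T by (force simp: E_def)
      then have "P (X s) = X s" using P by simp
      moreover have "at s within {0..\<tau>} = at s" using s by (simp add: at_within_Icc_at)
      ultimately have "(X has_vector_derivative F (X s)) (at s)"
        using ode_solution_at_within_Icc[OF X, of \<tau> "\<tau> + 1" s] s by simp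
      then have "(p has_real_derivative exp (- a * s) * (DV (X s) \<bullet> F (X s) - a * V (X s))) (at s)"
        unfolding p_def by (rule discounted_has_real_derivative[OF V])
      moreover have "exp (- a * s) * (DV (X s) \<bullet> F (X s) - a * V (X s)) \<le> 0"
        using growth by (simp add: mult_le_0_iff)
      ultimately show "\<exists>y. (p has_real_derivative y) (at s) \<and> y \<le> 0" by blast
    next
      show "continuous_on {0..\<tau>} p" unfolding p_def
        by (intro continuous_intros continuous_on_compose2[OF GDERIV_imp_continuous_on[OF V, of UNIV]] contX)
          auto
    qed (use \<tau>T in auto)
    then have "exp (a * \<tau>) * (exp (- a * \<tau>) * V (X \<tau>)) \<le> exp (a * \<tau>) * V x"
      unfolding p_def by (intro mult_left_mono) (auto simp: X0)
    then have "V (X \<tau>) \<le> exp (a * \<tau>) * V x"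
      by (simp add: mult.assoc[symmetric] flip: exp_add)
    also have "\<dots> \<le> exp (a * T) * V x"
      using \<tau>T a nonneg by (intro mult_right_mono) (auto intro: mult_left_mono)
    finally show False using R(2) \<tau>T by fastforce
  qed
  have "ode_solution F x T X"
    using X[of T] inside P unfolding ode_solution_def by (auto simp: less_imp_le)
  then show "\<exists>X. ode_solution F x T X" by blast
qed

text \<open>Radial unboundedness confines \<open>V x \<le> 1\<close> to a ball of radius
  \<open>R\<close>. On the compact shell between the radii \<open>\<epsilon>\<close> and
  \<open>R\<close>, \<open>V\<close> has a positive minimum; values of \<open>V\<close> below it and
  below 1 exclude the shell.\<close>

lemma positive_definite_small_imp_norm_small:
  fixes V :: "'a::euclidean_space \<Rightarrow> real"
  assumes cont: "continuous_on UNIV V" and pos: "positive_definite V"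
    and unbdd: "radially_unbounded V" and \<epsilon>: "\<epsilon> > 0"
  shows "\<exists>m>0. \<forall>x. V x < m \<longrightarrow> norm x < \<epsilon>"
proof -
  have V: "V x \<ge> 0" "x \<noteq> 0 \<Longrightarrow> V x > 0" for x
    using pos unfolding positive_definite_def by (metis less_eq_real_def)+
  obtain R where R: "\<And>x. V x \<le> 1 \<Longrightarrow> norm x \<le> R"
    using radially_unbounded_imp_bounded_sublevel[OF unbdd, of 1] V unfolding bounded_iff by auto
  define K where "K = cball 0 R - ball (0::'a) \<epsilon>"
  have K: "compact K" "\<And>x. x \<in> K \<Longrightarrow> x \<noteq> 0"
    using \<epsilon> by (auto simp: K_def intro: compact_diff)
  show ?thesis
  proof (cases "K = {}")
    \<comment> \<open>An empty shell offers no minimum; the threshold 1 suffices then.\<close>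
    case True
    then have "norm x < \<epsilon>" if "V x < 1" for x
      using R[of x] that by (force simp: K_def)
    then show ?thesis using zero_less_one by blast
  next
    case False
    then obtain z where z: "z \<in> K" "\<And>y. y \<in> K \<Longrightarrow> V z \<le> V y"
      using continuous_attains_inf[OF K(1) _ continuous_on_subset[OF cont]] by blast
    have "norm x < \<epsilon>" if "V x < min 1 (V z)" for x
      using R[of x] z(2)[of x] that by (force simp: K_def)
    moreover have "min 1 (V z) > 0" using V(2) K(2) z(1) by auto
    ultimately show ?thesis by blast
  qed
qed

text \<open>\<open>V (X r) + w * r\<close> has nonpositive derivative. Taking \<open>w = 0\<close>
  gives monotonicity of \<open>V\<close>, a positive \<open>w\<close> gives linear decrease.\<close>

lemma lyapunov_antimono:
  assumes X: "\<And>T. ode_solution F x T X" and V: "\<And>x. GDERIV V x :> DV x"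
    and decay: "\<And>s. s \<ge> 0 \<Longrightarrow> DV (X s) \<bullet> F (X s) \<le> - w" and st: "0 \<le> s" "s \<le> t"
  shows "V (X t) \<le> V (X s) - w * (t - s)"
proof -
  let ?p = "\<lambda>r. V (X r) + w * r"
  have d: "(?p has_real_derivative DV (X r) \<bullet> F (X r) + w) (at r within {0..t})" if "r \<in> {0..t}" for r
    by (rule derivative_eq_intros
        GDERIV_compose_vector_derivative[OF V ode_solution_at_within_Icc[OF X, of t "t + 1"]] refl)+
      (use that in auto)
  have "?p t \<le> ?p s"
  proof (rule DERIV_nonpos_imp_decreasing_open[where f="?p" and a=s and b=t])
    fix r assume r: "s < r" "r < t"
    have "at r within {0..t} = at r" using r st by (simp add: at_within_Icc_at)
    then show "\<exists>y. (?p has_real_derivative y) (at r) \<and> y \<le> 0"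
      using d[of r] decay[of r] r st by (intro exI conjI) (auto simp: less_imp_le)
  next
    have "continuous_on {0..t} ?p" using d by (rule DERIV_continuous_on)
    then show "continuous_on {s..t} ?p" by (rule continuous_on_subset) (use st in auto)
  qed (use st in auto)
  then show ?thesis by (simp add: algebra_simps)
qed

text \<open>If \<open>V\<close> stayed at or above \<open>m\<close> along the solution, the solution
  would remain in a compact set avoiding 0. There \<open>W\<close> has a positive minimum, and the
  resulting linear decrease would make \<open>V\<close> negative. Once below \<open>m\<close>,
  \<open>V\<close> stays there by monotonicity, which keeps the state within
  \<open>\<epsilon>\<close> of 0.\<close>

lemma lyapunov_solution_tendsto_0:
  fixes F :: "'a::euclidean_space \<Rightarrow> 'a"
  assumes X: "\<And>T. ode_solution F x T X" and V: "\<And>x. GDERIV V x :> DV x"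
    and pos: "positive_definite V" and unbdd: "radially_unbounded V"
    and W: "continuous_on UNIV W" "positive_definite W"
    and decay: "\<And>x. DV x \<bullet> F x = - W x"
  shows "(X \<longlongrightarrow> 0) at_top"
proof (rule tendstoI)
  fix \<epsilon> :: real assume "\<epsilon> > 0"
  have contV: "continuous_on UNIV V" by (rule GDERIV_imp_continuous_on[OF V])
  have V0: "V x \<ge> 0" for x
    using pos unfolding positive_definite_def by (metis less_eq_real_def)
  have W0: "W x \<ge> 0" for x
    using W unfolding positive_definite_def by (metis less_eq_real_def)
  have anti: "V (X t) \<le> V (X s)" if "0 \<le> s" "s \<le> t" for s t
    using lyapunov_antimono[OF X V, of 0 s t] decay W0 that by simp
  obtain m where m: "m > 0" "\<And>x. V x < m \<Longrightarrow> norm x < \<epsilon>"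
    using positive_definite_small_imp_norm_small[OF contV pos unbdd \<open>\<epsilon> > 0\<close>] by blast
  have "\<exists>t\<ge>0. V (X t) < m"
  proof (rule ccontr)
    assume "\<not> ?thesis"
    then have ge: "V (X t) \<ge> m" if "t \<ge> 0" for t using that not_less by blast
    define K where "K = {y. \<bar>V y\<bar> \<le> V (X 0)} \<inter> {y. m \<le> V y}"
    have inK: "X t \<in> K" if "t \<ge> 0" for t
      using that ge anti[of 0 t] V0 by (auto simp: K_def)
    have "closed K" unfolding K_def
      by (intro closed_Int closed_Collect_le continuous_intros contV)
    then have "compact K"
      using radially_unbounded_imp_bounded_sublevel[OF unbdd] unfolding K_def compact_eq_bounded_closed
      by (auto intro: bounded_Int)
    then obtain z where z: "z \<in> K" "\<And>y. y \<in> K \<Longrightarrow> W z \<le> W y"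
      using continuous_attains_inf[of K W] inK[of 0] continuous_on_subset[OF W(1)] by force
    have "z \<noteq> 0" using z(1) m(1) pos by (auto simp: K_def positive_definite_def)
    then have w: "W z > 0" using W(2) by (auto simp: positive_definite_def)
    \<comment> \<open>At this time the linear bound equals \<open>- W z\<close>, which is
      negative.\<close>
    let ?t = "V (X 0) / W z + 1"
    have t0: "?t \<ge> 0" using w V0 by (intro add_nonneg_nonneg divide_nonneg_pos) auto
    have "V (X ?t) \<le> V (X 0) - W z * (?t - 0)"
      by (rule lyapunov_antimono[where V=V, OF X V]) (use decay z(2) inK t0 in auto)
    also have "\<dots> < 0" using w by (simp add: field_simps)
    finally show False using V0[of "X ?t"] by linarith
  qed
  then obtain t where t: "t \<ge> 0" "V (X t) < m" by blast
  have "dist (X s) 0 < \<epsilon>" if "s \<ge> t" for s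
    using m(2)[of "X s"] anti[of t s] t that by simp
  then show "\<forall>\<^sub>F s in at_top. dist (X s) 0 < \<epsilon>" unfolding eventually_at_top_linorder by blast
qed

section \<open>Improper integrals\<close>

text \<open>Monotone convergence along the intervals \<open>{0..real n}\<close>. Nothing is known of
  \<open>g\<close> at negative times, so measurability is derived for the truncated functions from
  continuity on the half-line.\<close>

lemma nn_integral_atLeast_LIMSEQ:
  fixes g :: "real \<Rightarrow> real"
  assumes cont: "continuous_on {0..} g"
  shows "(\<lambda>n. \<integral>\<^sup>+t\<in>{0..real n}. ennreal (g t) \<partial>lborel) \<longlonglongrightarrow> (\<integral>\<^sup>+t\<in>{0..}. ennreal (g t) \<partial>lborel)"
proof (rule nn_integral_LIMSEQ)
  show "incseq (\<lambda>n t. ennreal (g t) * indicator {0..real n} t)"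
    by (auto simp: incseq_def le_fun_def intro!: mult_left_mono split: split_indicator)
  show "(\<lambda>t. ennreal (g t) * indicator {0..real n} t) \<in> borel_measurable lborel" for n
  proof -
    have "(\<lambda>t. indicator {0..real n} t *\<^sub>R g t) \<in> borel_measurable borel"
      by (rule borel_measurable_continuous_on_indicator) (auto intro: continuous_on_subset[OF cont])
    then have "(\<lambda>t. ennreal (indicator {0..real n} t *\<^sub>R g t)) \<in> borel_measurable lborel"
      by measurable
    moreover have "ennreal (indicator {0..real n} t *\<^sub>R g t) = ennreal (g t) * indicator {0..real n} t" for t
      by (simp split: split_indicator)
    ultimately show ?thesis by simp
  qed
  show "(\<lambda>n. ennreal (g t) * indicator {0..real n} t) \<longlonglongrightarrow> ennreal (g t) * indicator {0..} t" for t
  proof (rule tendsto_eventually)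
    show "\<forall>\<^sub>F n in sequentially. ennreal (g t) * indicator {0..real n} t = ennreal (g t) * indicator {0..} t"
      using eventually_ge_at_top[of "nat \<lceil>t\<rceil>"]
      by eventually_elim (auto split: split_indicator)
  qed
qed

text \<open>On \<open>{0..real n}\<close> the fundamental theorem of calculus gives
  \<open>p 0 - p (real n)\<close> as the integral of \<open>- p'\<close>. This is compared with the
  integral of \<open>g\<close>, and \<open>n\<close> tends to infinity.\<close>

lemma
  fixes g p p' :: "real \<Rightarrow> real"
  assumes cont: "continuous_on {0..} g" and nonneg: "\<And>t. t \<ge> 0 \<Longrightarrow> g t \<ge> 0"
    and p: "\<And>T t. t \<in> {0..T} \<Longrightarrow> (p has_real_derivative p' t) (at t within {0..T})"
    and lim: "(p \<longlongrightarrow> 0) at_top"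
  shows nn_integral_ge_of_derivative:
      "(\<And>t. t \<ge> 0 \<Longrightarrow> - p' t \<le> g t) \<Longrightarrow> ennreal (p 0) \<le> (\<integral>\<^sup>+t\<in>{0..}. ennreal (g t) \<partial>lborel)"
    and nn_integral_eq_of_derivative:
      "(\<And>t. t \<ge> 0 \<Longrightarrow> - p' t = g t) \<Longrightarrow> ennreal (p 0) = (\<integral>\<^sup>+t\<in>{0..}. ennreal (g t) \<partial>lborel)"
proof -
  have lim': "(\<lambda>n. ennreal (p 0 - p (real n))) \<longlonglongrightarrow> ennreal (p 0)"
    using tendsto_diff[OF tendsto_const[of "p 0"] filterlim_compose[OF lim filterlim_real_sequentially]]
    by (intro tendsto_ennrealI) simp
  have int: "((\<lambda>t. - p' t) has_integral p 0 - p (real n)) {0..real n}" for n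
    using has_integral_neg[OF fundamental_theorem_of_calculus[of 0 "real n" p p']] p
    by (simp add: has_real_derivative_iff_has_vector_derivative)
  have g: "(g has_integral integral {0..real n} g) {0..real n}" for n
    by (intro integrable_integral integrable_continuous_real continuous_on_subset[OF cont]) auto
  have nn: "(\<integral>\<^sup>+t\<in>{0..real n}. ennreal (g t) \<partial>lborel) = ennreal (integral {0..real n} g)" for n
    by (rule nn_integral_has_integral_lebesgue'[OF _ g]) (use nonneg in auto)
  note L = nn_integral_atLeast_LIMSEQ[OF cont, unfolded nn]
  {
    assume le: "\<And>t. t \<ge> 0 \<Longrightarrow> - p' t \<le> g t"
    have "p 0 - p (real n) \<le> integral {0..real n} g" for n
      by (rule has_integral_le[OF int g]) (use le in auto)
    then show "ennreal (p 0) \<le> (\<integral>\<^sup>+t\<in>{0..}. ennreal (g t) \<partial>lborel)"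
      using LIMSEQ_le[OF lim' L] ennreal_leI by blast
  next
    assume eq: "\<And>t. t \<ge> 0 \<Longrightarrow> - p' t = g t"
    have "(g has_integral p 0 - p (real n)) {0..real n}" for n
      using int[of n] by (rule has_integral_eq[rotated]) (use eq in auto)
    then have "integral {0..real n} g = p 0 - p (real n)" for n by (rule integral_unique)
    then show "ennreal (p 0) = (\<integral>\<^sup>+t\<in>{0..}. ennreal (g t) \<partial>lborel)"
      using LIMSEQ_unique[OF lim'] L by simp
  }
qed

section \<open>Closed-loop systems\<close>

lemma policies0D:
  assumes "\<pi> \<in> policies0 U"
  shows "continuous_on UNIV \<pi>" "\<pi> x \<in> U" "locally_lipschitz_on UNIV \<pi>" "\<pi> 0 = 0"
  using assms unfolding policies0_def policies_def by auto

lemma locally_lipschitz_on_under_policy: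
  assumes "locally_lipschitz_on (UNIV \<times> U) (\<lambda>(x, u). f x u)" "\<pi> \<in> policies0 U"
  shows "locally_lipschitz_on UNIV (under_policy f \<pi>)"
proof -
  have "locally_lipschitz_on UNIV (\<lambda>x. case (x, \<pi> x) of (x, u) \<Rightarrow> f x u)"
    by (rule locally_lipschitz_on_compose[OF _ assms(1)])
      (use policies0D[OF assms(2)] in
        \<open>auto intro: locally_lipschitz_on_Pair locally_lipschitz_on_ident\<close>)
  then show ?thesis by (simp add: under_policy_def[abs_def])
qed

lemma continuous_on_under_policy:
  assumes "continuous_on (UNIV \<times> U) (\<lambda>(x, u). c x u)" "\<pi> \<in> policies0 U"
  shows "continuous_on UNIV (under_policy c \<pi>)"
proof -
  have "continuous_on UNIV (\<lambda>x. case (x, \<pi> x) of (x, u) \<Rightarrow> c x u)"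
    by (rule continuous_on_compose2[OF assms(1)])
      (use policies0D[OF assms(2)] in \<open>auto intro!: continuous_intros\<close>)
  then show ?thesis by (simp add: under_policy_def[abs_def])
qed

lemma ode_solution_state:
  fixes f :: "'x::euclidean_space \<Rightarrow> 'u \<Rightarrow> 'x"
  assumes "locally_lipschitz_on UNIV (under_policy f \<pi>)" "tmax f \<pi> x = \<infinity>"
  shows "ode_solution (under_policy f \<pi>) x T (state f \<pi> x)"
  using ode_solution_flow[OF assms(1), of x T] assms(2)
  unfolding tmax_def state_def[abs_def] by simp

text \<open>Apply the preceding integral comparison to the discounted value
  \<open>p t = \<gamma> powr t * V (?X t)\<close> and the discounted running cost \<open>g\<close>.
  The assumed relation between \<open>V\<close> and the cost bounds \<open>- p'\<close> by
  \<open>g\<close>, or equates the two, and \<open>p 0 = V x\<close>.\<close>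

lemma
  fixes f :: "'x::euclidean_space \<Rightarrow> 'u \<Rightarrow> 'x" and V :: "'x \<Rightarrow> real"
  assumes F: "locally_lipschitz_on UNIV (under_policy f \<pi>)"
    and c: "continuous_on UNIV (under_policy c \<pi>)" "\<And>x. under_policy c \<pi> x \<ge> 0"
    and \<gamma>: "0 < \<gamma>"
    and V: "\<And>x. GDERIV V x :> DV x"
    and tmax: "tmax f \<pi> x = \<infinity>"
    and lim: "((\<lambda>t. \<gamma> powr t * V (state f \<pi> x t)) \<longlongrightarrow> 0) at_top"
  shows cost_value_ge:
      "(\<And>x. - ln \<gamma> * V x - DV x \<bullet> under_policy f \<pi> x \<le> under_policy c \<pi> x)
        \<Longrightarrow> ennreal (V x) \<le> cost_value f c \<gamma> \<pi> x"
    and cost_value_eq: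
      "(\<And>x. - ln \<gamma> * V x - DV x \<bullet> under_policy f \<pi> x = under_policy c \<pi> x)
        \<Longrightarrow> ennreal (V x) = cost_value f c \<gamma> \<pi> x"
proof -
  let ?X = "state f \<pi> x" and ?F = "under_policy f \<pi>" and ?c = "under_policy c \<pi>"
  have X: "ode_solution ?F x T ?X" for T by (rule ode_solution_state[OF F tmax])
  have powr: "\<gamma> powr t = exp (- (- ln \<gamma>) * t)" for t
    using \<gamma> by (simp add: powr_def mult.commute)
  define p where "p t = \<gamma> powr t * V (?X t)" for t
  define p' where "p' t = \<gamma> powr t * (DV (?X t) \<bullet> ?F (?X t) - (- ln \<gamma>) * V (?X t))" for t
  define g where "g t = \<gamma> powr t * ?c (?X t)" for t
  have p0: "p 0 = V x" using X[of 0] \<gamma> by (simp add: p_def ode_solution_def)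
  have p: "(p has_real_derivative p' t) (at t within {0..T})" if "t \<in> {0..T}" for t T
    unfolding p_def[abs_def] p'_def powr
    by (rule discounted_has_real_derivative[OF V ode_solution_at_within_Icc[OF X, of T "T + 1"]])
      (use that in auto)
  \<comment> \<open>Solutions are given on bounded intervals only; continuity at \<open>t\<close> is
    read off \<open>{0..t+1}\<close>.\<close>
  have "continuous_on {0..} ?X"
    unfolding continuous_on_eq_continuous_within
  proof
    fix t :: real assume t: "t \<in> {0..}"
    have "continuous (at t within {0..t + 1}) ?X"
      using ode_solution_continuous_on[OF X, of "t + 1" "t + 2"] t
      by (auto simp: continuous_on_eq_continuous_within)
    moreover have "at t within {0..} = at t within {0..t+1}"
      by (rule at_within_nhd[of _ "{..<t+1}"]) (use t in auto)
    ultimately show "continuous (at t within {0..}) ?X" by simp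
  qed
  then have g: "continuous_on {0..} g"
    unfolding g_def powr by (intro continuous_intros continuous_on_compose2[OF c(1)]) auto
  have cost: "cost_value f c \<gamma> \<pi> x = (\<integral>\<^sup>+t\<in>{0..}. ennreal (g t) \<partial>lborel)"
    using tmax by (simp add: cost_value_def g_def)
  have lim_p: "(p \<longlongrightarrow> 0) at_top" using lim unfolding p_def[abs_def] .
  have p'_eq: "- p' t = \<gamma> powr t * (- ln \<gamma> * V (?X t) - DV (?X t) \<bullet> ?F (?X t))" for t
    by (simp add: p'_def algebra_simps)
  have g0: "g t \<ge> 0" for t using c(2) by (simp add: g_def)
  show "ennreal (V x) \<le> cost_value f c \<gamma> \<pi> x"
    if "\<And>x. - ln \<gamma> * V x - DV x \<bullet> ?F x \<le> ?c x"
    unfolding cost p0[symmetric]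
    by (rule nn_integral_ge_of_derivative[OF g g0 p lim_p])
      (simp_all only: p'_eq g_def mult_left_mono[OF that] powr_ge_zero)
  show "ennreal (V x) = cost_value f c \<gamma> \<pi> x"
    if "\<And>x. - ln \<gamma> * V x - DV x \<bullet> ?F x = ?c x"
    unfolding cost p0[symmetric]
    by (rule nn_integral_eq_of_derivative[OF g g0 p lim_p])
      (simp_all only: p'_eq g_def that)
qed

text \<open>Since \<open>V\<close> does not increase, solutions exist globally by the growth
  criterion with rate 0. For stability, starting close enough to 0 puts \<open>V\<close> below a
  level \<open>m\<close> whose sublevel set lies in the \<open>\<epsilon>\<close>-ball, and
  \<open>V\<close> stays below \<open>m\<close>. Attraction uses the strict decrease through
  \<open>W\<close>.\<close>

lemma lyapunov_imp_globally_asymptotically_stable: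
  fixes f :: "'x::euclidean_space \<Rightarrow> 'u \<Rightarrow> 'x" and V :: "'x \<Rightarrow> real"
  assumes F: "locally_lipschitz_on UNIV (under_policy f \<pi>)"
    and V: "\<And>x. GDERIV V x :> DV x"
    and pos: "positive_definite V" and unbdd: "radially_unbounded V"
    and W: "continuous_on UNIV W" "positive_definite W"
    and decay: "\<And>x. DV x \<bullet> under_policy f \<pi> x = - W x"
  shows "globally_asymptotically_stable f \<pi>"
proof -
  have V0: "V x \<ge> 0" and W0: "W x \<ge> 0" for x
    using pos W unfolding positive_definite_def by (metis less_eq_real_def)+
  have contV: "continuous_on UNIV V" by (rule GDERIV_imp_continuous_on[OF V])
  have tmax: "tmax f \<pi> x = \<infinity>" for x
    unfolding tmax_def by (rule lyapunov_ode_tmax[OF F V V0 unbdd, of 0]) (use decay W0 in auto)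
  have X: "ode_solution (under_policy f \<pi>) x T (state f \<pi> x)" for x T
    by (rule ode_solution_state[OF F tmax])
  have "lyapunov_stable f \<pi>"
    unfolding lyapunov_stable_def
  proof (intro allI impI)
    fix \<epsilon> :: real assume "\<epsilon> > 0"
    then obtain m where m: "m > 0" "\<And>x. V x < m \<Longrightarrow> norm x < \<epsilon>"
      using positive_definite_small_imp_norm_small[OF contV pos unbdd] by blast
    obtain \<delta> where \<delta>: "\<delta> > 0" "\<And>x. dist x 0 < \<delta> \<Longrightarrow> dist (V x) (V 0) < m"
      using contV m(1) unfolding continuous_on_iff by (metis UNIV_I)
    have "norm (state f \<pi> x t) < \<epsilon>" if "norm x < \<delta>" "t \<ge> 0" for x t
    proof (rule m(2))
      have "V (state f \<pi> x t) \<le> V (state f \<pi> x 0) - 0 * (t - 0)"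
        by (rule lyapunov_antimono[where V=V, OF X V]) (use decay W0 that in auto)
      also have "\<dots> = V x" using X[of x 0] by (simp add: ode_solution_def)
      also have "V x < m" using \<delta>(2)[of x] that pos by (simp add: positive_definite_def dist_real_def)
      finally show "V (state f \<pi> x t) < m" .
    qed
    then show "\<exists>\<delta>>0. \<forall>x. norm x < \<delta> \<longrightarrow> tmax f \<pi> x = \<infinity> \<and> (\<forall>t\<ge>0. norm (state f \<pi> x t) < \<epsilon>)"
      using \<delta>(1) tmax by blast
  qed
  moreover have "globally_attractive f \<pi>"
    unfolding globally_attractive_def
    using tmax lyapunov_solution_tendsto_0[OF X V pos unbdd W decay] by blast
  ultimately show ?thesis unfolding globally_asymptotically_stable_def by blast
qed

text \<open>\<open>V\<close> grows at most at rate \<open>a - \<kappa>\<close>, so discounting at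
  rate \<open>a\<close> leaves the upper bound \<open>exp (- \<kappa> * t) * V x\<close>.\<close>

lemma discounted_lyapunov_tendsto_0:
  assumes X: "\<And>T. ode_solution F x T X" and V: "\<And>x. GDERIV V x :> DV x"
    and nonneg: "\<And>x. V x \<ge> 0" and \<kappa>: "\<kappa> > 0"
    and decay: "\<And>x. DV x \<bullet> F x \<le> (a - \<kappa>) * V x"
  shows "((\<lambda>t. exp (- a * t) * V (X t)) \<longlongrightarrow> 0) at_top"
proof (rule tendsto_sandwich[OF _ _ tendsto_const])
  let ?p = "\<lambda>t. exp (- (a - \<kappa>) * t) * V (X t)"
  show "\<forall>\<^sub>F t in at_top. exp (- a * t) * V (X t) \<le> exp (- \<kappa> * t) * V x"
    using eventually_ge_at_top[of 0]
  proof eventually_elim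
    fix t :: real assume t: "t \<ge> 0"
    have d: "(?p has_real_derivative
        exp (- (a - \<kappa>) * s) * (DV (X s) \<bullet> F (X s) - (a - \<kappa>) * V (X s))) (at s within {0..t})"
      if "s \<in> {0..t}" for s
      by (rule discounted_has_real_derivative[OF V ode_solution_at_within_Icc[OF X, of t "t + 1"]])
        (use that in auto)
    have "?p t \<le> ?p 0"
    proof (rule DERIV_nonpos_imp_decreasing_open[where f="?p" and a=0 and b=t])
      fix s assume s: "0 < s" "s < t"
      have "at s within {0..t} = at s" using s by (simp add: at_within_Icc_at)
      moreover have "exp (- (a - \<kappa>) * s) * (DV (X s) \<bullet> F (X s) - (a - \<kappa>) * V (X s)) \<le> 0"
        using decay by (intro mult_nonneg_nonpos) auto
      ultimately show "\<exists>y. (?p has_real_derivative y) (at s) \<and> y \<le> 0"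
        using d[of s] s by auto
    next
      show "continuous_on {0..t} ?p" using d by (rule DERIV_continuous_on)
    qed (rule t)
    then have "exp (- \<kappa> * t) * ?p t \<le> exp (- \<kappa> * t) * ?p 0" by (rule mult_left_mono) simp
    moreover have "exp (- \<kappa> * t) * ?p t = exp (- a * t) * V (X t)"
      by (simp add: left_diff_distrib flip: mult.assoc exp_add)
    moreover have "?p 0 = V x" using X[of 0] by (simp add: ode_solution_def)
    ultimately show "exp (- a * t) * V (X t) \<le> exp (- \<kappa> * t) * V x" by metis
  qed
  have "((\<lambda>t. exp (- (\<kappa> * t)) * V x) \<longlongrightarrow> 0 * V x) at_top"
    by (intro tendsto_mult tendsto_const filterlim_compose[OF exp_at_bot]
        filterlim_compose[OF filterlim_uminus_at_bot_at_top]
        filterlim_tendsto_pos_mult_at_top[OF tendsto_const \<kappa> filterlim_ident])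
  then show "((\<lambda>t. exp (- \<kappa> * t) * V x) \<longlongrightarrow> 0) at_top" by simp
qed (auto simp: nonneg)

section \<open>Verification theorem for the Hamilton-Jacobi-Bellman equation\<close>

theorem theoremE8:
  fixes U :: "(real ^ 'm) set"
    and f :: "real ^ 'l \<Rightarrow> real ^ 'm \<Rightarrow> real ^ 'l"
    and c :: "real ^ 'l \<Rightarrow> real ^ 'm \<Rightarrow> real"
    and \<gamma> \<alpha> :: real
    and ustar :: "real ^ 'l \<Rightarrow> real ^ 'l \<Rightarrow> real ^ 'm"
    and vstar Jstar :: "real ^ 'l \<Rightarrow> real"
    and pistar :: "real ^ 'l \<Rightarrow> real ^ 'm"
  assumes U_shape: "\<exists>W. open W \<and> (U = W \<union> frontier W \<or> U = W)"
    and U_zero: "0 \<in> U"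
    and f_lipschitz: "locally_lipschitz_on (UNIV \<times> U) (\<lambda>(x, u). f x u)"
    and f_zero: "f 0 0 = 0"
    and c_continuous: "continuous_on (UNIV \<times> U) (\<lambda>(x, u). c x u)"
    and c_zero: "c 0 0 = 0"
    and c_pos: "\<And>x u. u \<in> U \<Longrightarrow> (x, u) \<noteq> (0, 0) \<Longrightarrow> c x u > 0"
    and gamma: "0 < \<gamma>" "\<gamma> \<le> 1"
    and alpha: "\<alpha> = - ln \<gamma>"
    and ustar_lipschitz: "locally_lipschitz_on UNIV (\<lambda>(x, p). ustar x p)"
    and ustar_argmax:
      "\<And>x p. is_arg_max (\<lambda>u. hamiltonian f c x u p) (\<lambda>u. u \<in> U) (ustar x p)"
    and admissible_nonempty: "admissible_policies f c \<gamma> U \<noteq> {}"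
    and value_C1:
      "\<And>\<pi>. \<pi> \<in> admissible_policies f c \<gamma> U \<Longrightarrow> C1_lipschitz_gradient (value_fun f c \<gamma> \<pi>)"
    and cost_nonvanishing:
      "\<And>\<pi>. \<pi> \<in> policies0 U \<Longrightarrow> radially_nonvanishing (under_policy c \<pi>)"
    and HJB: "\<And>x. is_maximum_of (\<alpha> * vstar x) ((\<lambda>u. hamiltonian f c x u (grad vstar x)) ` U)"
    and pistar: "\<And>x. pistar x = ustar x (grad vstar x)"
    and Jstar: "\<And>x. Jstar x = - vstar x"
    and Jstar_C1: "C1_lipschitz_gradient Jstar"
    and Jstar_pos_def: "positive_definite Jstar"
    and Jstar_unbounded: "radially_unbounded Jstar"
    and discounted: "\<gamma> \<noteq> 1 \<Longrightarrow>
      globally_attractive f pistar \<or> (\<exists>\<kappa>>0. \<forall>x. \<kappa> * Jstar x \<le> under_policy c pistar x)"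
  shows "pistar \<in> admissible_policies f c \<gamma> U \<and>
    (\<forall>x. ennreal (Jstar x) = cost_value f c \<gamma> pistar x) \<and>
    (\<forall>\<pi>\<in>policies0 U.
       (\<forall>x. tmax f \<pi> x = \<infinity> \<and> ((\<lambda>t. \<gamma> powr t * Jstar (state f \<pi> x t)) \<longlongrightarrow> 0) at_top)
       \<longrightarrow> (\<forall>x. ennreal (Jstar x) \<le> cost_value f c \<gamma> \<pi> x)) \<and>
    (\<gamma> = 1 \<or> (\<forall>x. x \<noteq> 0 \<longrightarrow> \<alpha> * Jstar x < under_policy c pistar x)
       \<longrightarrow> globally_asymptotically_stable f pistar)"
proof -
  define DJ where "DJ = grad Jstar"
  have DJ: "\<And>x. GDERIV Jstar x :> DJ x" and DJ_lip: "locally_lipschitz_on UNIV DJ"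
    using Jstar_C1 by (auto simp: C1_lipschitz_gradient_def DJ_def)
  \<comment> \<open>Derivatives are unique, so the description \<open>grad\<close> can be evaluated.
    This transfers the gradient of \<open>Jstar\<close>, assumed to exist, to that of
    \<open>vstar\<close>, in which the HJB equation is stated.\<close>
  have grad_eq: "grad g x = D" if "GDERIV g x :> D" for g :: "real ^ 'l \<Rightarrow> real" and x D
    unfolding grad_def
  proof (rule the_equality)
    fix D' assume "GDERIV g x :> D'"
    then have "(\<lambda>h. h \<bullet> D') = (\<lambda>h. h \<bullet> D)"
      using that has_derivative_unique unfolding gderiv_def by blast
    then have "h \<bullet> D' = h \<bullet> D" for h by (rule fun_cong)
    then show "D' = D" using vector_eq_ldot by blast
  qed (rule that)
  have "vstar = (\<lambda>x. - Jstar x)" using Jstar by auto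
  then have Dv: "grad vstar x = - DJ x" for x
    using grad_eq[OF GDERIV_minus[OF DJ]] by simp
  have J0: "Jstar x \<ge> 0" "Jstar 0 = 0" for x
    using Jstar_pos_def unfolding positive_definite_def by (metis less_eq_real_def)+
  have \<alpha>: "\<alpha> \<ge> 0" using gamma by (simp add: alpha)
  have powr: "\<gamma> powr t = exp (- \<alpha> * t)" for t
    using gamma by (simp add: alpha powr_def mult.commute)

  have HJB_le: "\<alpha> * Jstar x - DJ x \<bullet> f x u \<le> c x u" if "u \<in> U" for x u
    using HJB[of x] that unfolding is_maximum_of_def hamiltonian_def Dv
    by (force simp: Jstar)
  have pistar_U: "pistar x \<in> U" for x
    using ustar_argmax unfolding pistar is_arg_max_def by blast
  \<comment> \<open>The maximum in the HJB equation is attained at some \<open>u\<close>, and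
    \<open>pistar x\<close> does at least as well, so the inequality for general actions is tight at
    \<open>pistar x\<close>.\<close>
  have HJB_eq: "\<alpha> * Jstar x - DJ x \<bullet> f x (pistar x) = c x (pistar x)" for x
  proof (rule antisym[OF HJB_le[OF pistar_U]])
    obtain u where u: "u \<in> U" "\<alpha> * vstar x = hamiltonian f c x u (grad vstar x)"
      using HJB[of x] unfolding is_maximum_of_def by blast
    have "hamiltonian f c x u (grad vstar x) \<le> hamiltonian f c x (pistar x) (grad vstar x)"
      using ustar_argmax[of x "grad vstar x"] u(1) unfolding is_arg_max_def pistar[symmetric]
      by force
    then show "c x (pistar x) \<le> \<alpha> * Jstar x - DJ x \<bullet> f x (pistar x)"
      using u(2) unfolding hamiltonian_def Dv by (simp add: Jstar)
  qed

  \<comment> \<open>\<open>Jstar\<close> has its minimum at 0. With a vanishing gradient the HJB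
    equation at 0 reduces to \<open>c 0 (pistar 0) = 0\<close>, and positive definiteness of the
    cost then forces \<open>pistar 0 = 0\<close>.\<close>
  have "DJ 0 = 0"
  proof -
    have "(\<lambda>h. h \<bullet> DJ 0) = (\<lambda>h. 0)"
      by (rule has_derivative_local_min[of Jstar _ 0])
        (use DJ[of 0] J0 in \<open>auto simp: gderiv_def\<close>)
    then show ?thesis by (metis inner_eq_zero_iff)
  qed
  then have "c 0 (pistar 0) = 0" using HJB_eq[of 0] J0 by simp
  then have pistar_0: "pistar 0 = 0" using c_pos[of "pistar 0" 0] pistar_U by force
  have pistar_lip: "locally_lipschitz_on UNIV pistar"
  proof -
    have "locally_lipschitz_on UNIV (\<lambda>x. case (x, - DJ x) of (x, p) \<Rightarrow> ustar x p)"
      by (intro locally_lipschitz_on_compose[OF _ ustar_lipschitz] locally_lipschitz_on_Pair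
          locally_lipschitz_on_ident locally_lipschitz_on_uminus DJ_lip) simp
    then show ?thesis by (simp add: pistar[abs_def] Dv)
  qed
  have pistar0: "pistar \<in> policies0 U"
    using pistar_lip pistar_0 pistar_U locally_lipschitz_on_imp_continuous_on
    by (auto simp: policies0_def policies_def)

  \<comment> \<open>Closed-loop dynamics under \<open>pistar\<close>\<close>
  let ?F = "under_policy f pistar" and ?c = "under_policy c pistar"
  have F_lip: "locally_lipschitz_on UNIV ?F"
    by (rule locally_lipschitz_on_under_policy[OF f_lipschitz pistar0])
  have c_cont: "continuous_on UNIV (under_policy c \<pi>)"
    and c_nonneg: "under_policy c \<pi> x \<ge> 0" if "\<pi> \<in> policies0 U" for \<pi> x
  proof -
    show "continuous_on UNIV (under_policy c \<pi>)"
      by (rule continuous_on_under_policy[OF c_continuous that])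
    show "under_policy c \<pi> x \<ge> 0"
      using c_pos[OF policies0D(2)[OF that], of x x] c_zero
      by (cases "(x, \<pi> x) = (0, 0)") (auto simp: under_policy_def)
  qed
  have dyn: "DJ x \<bullet> ?F x = \<alpha> * Jstar x - ?c x" for x
    using HJB_eq[of x] by (simp add: under_policy_def)
  have tmax: "tmax f pistar x = \<infinity>" for x
    unfolding tmax_def
    by (rule lyapunov_ode_tmax[OF F_lip DJ J0(1) Jstar_unbounded \<alpha>])
      (use dyn c_nonneg[OF pistar0] in auto)
  have X: "ode_solution ?F x T (state f pistar x)" for x T
    by (rule ode_solution_state[OF F_lip tmax])

  \<comment> \<open>The decay rate is \<open>?c x - \<alpha> * Jstar x\<close>. If
    \<open>\<gamma> = 1\<close> then \<open>\<alpha> = 0\<close>, and it is the running cost itself,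
    positive away from 0.\<close>
  have gas: "globally_asymptotically_stable f pistar"
    if "\<gamma> = 1 \<or> (\<forall>x. x \<noteq> 0 \<longrightarrow> \<alpha> * Jstar x < ?c x)"
  proof (rule lyapunov_imp_globally_asymptotically_stable[OF F_lip DJ Jstar_pos_def Jstar_unbounded])
    show "continuous_on UNIV (\<lambda>x. ?c x - \<alpha> * Jstar x)"
      by (intro continuous_intros c_cont pistar0 GDERIV_imp_continuous_on[OF DJ])
    have "\<alpha> * Jstar x < ?c x" if "x \<noteq> 0" for x
      using \<open>\<gamma> = 1 \<or> _\<close> that c_pos[OF pistar_U, of x x] by (auto simp: alpha under_policy_def)
    then show "positive_definite (\<lambda>x. ?c x - \<alpha> * Jstar x)"
      using J0 c_zero pistar_0 by (auto simp: positive_definite_def under_policy_def)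
  qed (simp add: dyn)

  have lim: "((\<lambda>t. \<gamma> powr t * Jstar (state f pistar x t)) \<longlongrightarrow> 0) at_top" for x
  proof -
    \<comment> \<open>The case \<open>\<gamma> = 1\<close> falls under the first alternative,
      because asymptotic stability is already established there.\<close>
    consider "globally_attractive f pistar" | \<kappa> where "\<kappa> > 0" "\<And>x. \<kappa> * Jstar x \<le> ?c x"
      using gas discounted unfolding globally_asymptotically_stable_def by blast
    then show ?thesis
    proof cases
      case 1
      have "isCont Jstar 0"
        using GDERIV_imp_continuous_on[OF DJ, of UNIV] by (simp add: continuous_on_eq_continuous_at)
      then have J_lim: "((\<lambda>t. Jstar (state f pistar x t)) \<longlongrightarrow> 0) at_top"
        using isCont_tendsto_compose[of 0 Jstar "state f pistar x"] 1 J0(2)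
        unfolding globally_attractive_def by metis
      show ?thesis
      \<comment> \<open>The discount is at most 1 at nonnegative times, so the undiscounted value,
        which tends to \<open>Jstar 0 = 0\<close>, is an upper bound.\<close>
      proof (rule tendsto_sandwich[OF _ _ tendsto_const J_lim])
        show "\<forall>\<^sub>F t in at_top. \<gamma> powr t * Jstar (state f pistar x t) \<le> Jstar (state f pistar x t)"
          using eventually_ge_at_top[of 0]
          by eventually_elim (auto simp: powr J0 \<alpha> intro!: mult_left_le_one_le)
      qed (auto simp: J0)
    next
      case (2 \<kappa>)
      show ?thesis
        unfolding powr
        \<comment> \<open>Inserting \<open>\<kappa> * Jstar x \<le> ?c x\<close> into
          \<open>dyn\<close> bounds the derivative of \<open>Jstar\<close> along solutions by
          \<open>(\<alpha> - \<kappa>) * Jstar x\<close>.\<close>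
        by (rule discounted_lyapunov_tendsto_0[OF X DJ J0(1) 2(1)])
          (use 2(2) in \<open>simp add: dyn algebra_simps\<close>)
    qed
  qed

  \<comment> \<open>Cost of \<open>pistar\<close> and comparison with other policies\<close>
  have cost: "ennreal (Jstar x) = cost_value f c \<gamma> pistar x" for x
    by (rule cost_value_eq[OF F_lip c_cont[OF pistar0] c_nonneg[OF pistar0] gamma(1) DJ tmax lim])
      (simp add: dyn flip: alpha)
  have "cost_value f c \<gamma> pistar x < \<infinity>" for x
    unfolding cost[symmetric] by simp
  then have "pistar \<in> admissible_policies f c \<gamma> U"
    using pistar0 by (simp add: admissible_policies_def)
  moreover have "ennreal (Jstar x) \<le> cost_value f c \<gamma> \<pi> x"
    if "\<pi> \<in> policies0 U"
      "\<forall>x. tmax f \<pi> x = \<infinity> \<and> ((\<lambda>t. \<gamma> powr t * Jstar (state f \<pi> x t)) \<longlongrightarrow> 0) at_top" for \<pi> x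
    by (rule cost_value_ge[OF locally_lipschitz_on_under_policy[OF f_lipschitz that(1)]
        c_cont[OF that(1)] c_nonneg[OF that(1)] gamma(1) DJ])
      (use that(2) HJB_le policies0D(2)[OF that(1)] in \<open>auto simp: under_policy_def simp flip: alpha\<close>)
  ultimately show ?thesis using cost gas by blast
qed

end
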